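(* Let $\mathcal{A}=\{H_1,\dots,H_n\}$ be a central and essential hyperplane arrangement in $V=\mathbb{R}^\ell$, with fixed defining linear forms $\alpha_i\in V^*$. Let $\bm{\varepsilon}\in\{+,-\}^n$ be a sign vector such that the system of half-spaces $h(\bm{\varepsilon})$ is locally consistent. Let $\theta$ be a vector field on the unit sphere $S=S^{\ell-1}\subset V$ compatible with $h(\bm{\varepsilon})$, and let $S(\bm{\varepsilon})=\{x+\sqrt{-1}\,\theta(x)\mid x\in S\}\subset M(\mathcal{A})$ be the resulting embedded sphere. Then $S(\bm{\varepsilon})$ is homotopically trivial in $M(\mathcal{A})$ (i.e. the map $S\to M(\mathcal{A})$, $x\mapsto x+\sqrt{-1}\,\theta(x)$, is null-homotopic) if and only if $h(\bm{\varepsilon})$ is globally consistent.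
   Context: A hyperplane arrangement $\mathcal{A}=\{H_1,\dots,H_n\}$ is a finite set of (distinct) hyperplanes in $V=\mathbb{R}^\ell$; it is central and essential if all $H_i$ are linear hyperplanes and $\bigcap_{i=1}^n H_i=\{0\}$. Fix a linear form $\alpha_i\in V^*$ with $H_i=\ker\alpha_i$ for each $i$, and put $H_i^{+}=\{x\in V\mid\alpha_i(x)>0\}$, $H_i^{-}=\{x\in V\mid\alpha_i(x)<0\}$. A sign vector $\bm{\varepsilon}=(\varepsilon_1,\dots,\varepsilon_n)\in\{+,-\}^n$ determines the system of half-spaces $h(\bm{\varepsilon})=(H_1^{\varepsilon_1},\dots,H_n^{\varepsilon_n})$. The system $h(\bm{\varepsilon})$ is consistent (or globally consistent) if $\bigcap_{i=1}^n H_i^{\varepsilon_i}\neq\emptyset$. Let $L(\mathcal{A})=\{\bigcap_{H\in\mathcal{B}}H\mid\mathcal{B}\subset\mathcal{A}\}$ be the set of intersections (with $V$ the intersection of the empty family). For $X\in L(\mathcal{A})$ let $\mathcal{A}_X=\{H\in\mathcal{A}\mid H\supset X\}$. The system $h(\bm{\varepsilon})$ is consistent at $X$ if $\bigcap_{H_i\in\mathcal{A}_X}H_i^{\varepsilon_i}\neq\emptyset$. It is locally consistent if it is consistent at $X$ for every $X\in L(\mathcal{A})\setminus\{\{0\}\}$. The complexified complement is $M(\mathcal{A})=\mathbb{C}^\ell\setminus\bigcup_{i=1}^n (H_i\otimes\mathbb{C})$. Writing points of $\mathbb{C}^\ell$ as $x+\sqrt{-1}\,v$ with $x,v\in\mathbb{R}^\ell$,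 one has $x+\sqrt{-1}\,v\in H_i\otimes\mathbb{C}$ if and only if $\alpha_i(x)=\alpha_i(v)=0$. Let $S=\{x\in\mathbb{R}^\ell\mid |x|=1\}$. A vector field on $S$ is a continuous assignment $x\mapsto\theta(x)\in T_xV\cong V$ for $x\in S$ (not necessarily tangent to $S$). It is compatible with $h(\bm{\varepsilon})$ if for every $i$ and every $x\in S\cap H_i$, $\theta(x)\in H_i^{\varepsilon_i}$ (identifying $T_xV$ with $V$), i.e. $\theta(x)$ is nonzero and points to the side $H_i^{\varepsilon_i}$ of $H_i$. When $h(\bm{\varepsilon})$ is locally consistent such $\theta$ exists, $S(\bm{\varepsilon})\subset M(\mathcal{A})$, and the homotopy class of $S(\bm{\varepsilon})$ does not depend on the choice of $\theta$. *)

theory Defs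
  imports "HOL-Analysis.Analysis"
begin

definition ker_form :: "('a::real_vector \<Rightarrow> real) \<Rightarrow> 'a set" where
  "ker_form a = {x. a x = 0}"

datatype pm = Plus | Minus

fun half_space :: "('a::real_vector \<Rightarrow> real) \<Rightarrow> pm \<Rightarrow> 'a set" where
  "half_space a Plus = {x. a x > 0}"
| "half_space a Minus = {x. a x < 0}"

text \<open>An arrangement with fixed defining forms is given by \<open>n\<close> and a family \<open>\<alpha>\<close>, of which only
  \<open>\<alpha> 1, \<dots>, \<alpha> n\<close> matter; likewise for sign vectors \<open>\<epsilon>\<close>.\<close>

definition arrangement :: "nat \<Rightarrow> (nat \<Rightarrow> 'a::real_vector \<Rightarrow> real) \<Rightarrow> 'a set set" where
  "arrangement n \<alpha> = (\<lambda>i. ker_form (\<alpha> i)) ` {1..n}"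

text \<open>The nonvanishing condition makes each kernel a hyperplane; injectivity says that
  the \<open>n\<close> hyperplanes are distinct.\<close>

definition central_arrangement :: "nat \<Rightarrow> (nat \<Rightarrow> 'a::real_vector \<Rightarrow> real) \<Rightarrow> bool" where
  "central_arrangement n \<alpha> \<longleftrightarrow>
     (\<forall>i\<in>{1..n}. linear (\<alpha> i) \<and> (\<exists>x. \<alpha> i x \<noteq> 0)) \<and>
     inj_on (\<lambda>i. ker_form (\<alpha> i)) {1..n}"

definition essential_arrangement :: "nat \<Rightarrow> (nat \<Rightarrow> 'a::real_vector \<Rightarrow> real) \<Rightarrow> bool" where
  "essential_arrangement n \<alpha> \<longleftrightarrow> \<Inter>(arrangement n \<alpha>) = {0}"

text \<open>Since \<open>\<Inter>{} = UNIV\<close>, the whole space is a member.\<close>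

definition intersections :: "'a set set \<Rightarrow> 'a set set" where
  "intersections A = {\<Inter>B | B. B \<subseteq> A}"

definition localization :: "'a set set \<Rightarrow> 'a set \<Rightarrow> 'a set set" where
  "localization A X = {H \<in> A. X \<subseteq> H}"

definition globally_consistent ::
    "nat \<Rightarrow> (nat \<Rightarrow> 'a::real_vector \<Rightarrow> real) \<Rightarrow> (nat \<Rightarrow> pm) \<Rightarrow> bool" where
  "globally_consistent n \<alpha> \<epsilon> \<longleftrightarrow> (\<Inter>i\<in>{1..n}. half_space (\<alpha> i) (\<epsilon> i)) \<noteq> {}"

definition consistent_at ::
    "nat \<Rightarrow> (nat \<Rightarrow> 'a::real_vector \<Rightarrow> real) \<Rightarrow> (nat \<Rightarrow> pm) \<Rightarrow> 'a set \<Rightarrow> bool" where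
  "consistent_at n \<alpha> \<epsilon> X \<longleftrightarrow>
     (\<Inter>i\<in>{i\<in>{1..n}. ker_form (\<alpha> i) \<in> localization (arrangement n \<alpha>) X}.
        half_space (\<alpha> i) (\<epsilon> i)) \<noteq> {}"

definition locally_consistent ::
    "nat \<Rightarrow> (nat \<Rightarrow> 'a::real_vector \<Rightarrow> real) \<Rightarrow> (nat \<Rightarrow> pm) \<Rightarrow> bool" where
  "locally_consistent n \<alpha> \<epsilon> \<longleftrightarrow>
     (\<forall>X \<in> intersections (arrangement n \<alpha>) - {{0}}. consistent_at n \<alpha> \<epsilon> X)"

text \<open>The point \<open>x + \<i> v\<close> of complex space.\<close>

definition complex_point :: "real^'l \<Rightarrow> real^'l \<Rightarrow> complex^'l" where
  "complex_point x v = (\<chi> k. Complex (x $ k) (v $ k))"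

text \<open>For a real subspace \<open>H\<close>, the complex subspace \<open>H \<otimes> \<complex> = H + \<i> H\<close>.\<close>

definition complexify :: "(real^'l) set \<Rightarrow> (complex^'l) set" where
  "complexify H = {complex_point x v | x v. x \<in> H \<and> v \<in> H}"

definition complexified_complement :: "nat \<Rightarrow> (nat \<Rightarrow> real^'l \<Rightarrow> real) \<Rightarrow> (complex^'l) set" where
  "complexified_complement n \<alpha> = UNIV - (\<Union>H\<in>arrangement n \<alpha>. complexify H)"

text \<open>The field is not required to be tangent to the sphere.\<close>

definition sphere_vector_field :: "('a::real_normed_vector \<Rightarrow> 'a) \<Rightarrow> bool" where
  "sphere_vector_field \<theta> \<longleftrightarrow> continuous_on (sphere 0 1) \<theta>"

definition compatible ::
    "nat \<Rightarrow> (nat \<Rightarrow> 'a::real_normed_vector \<Rightarrow> real) \<Rightarrow> (nat \<Rightarrow> pm) \<Rightarrow> ('a \<Rightarrow> 'a) \<Rightarrow> bool" where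
  "compatible n \<alpha> \<epsilon> \<theta> \<longleftrightarrow>
     (\<forall>i\<in>{1..n}. \<forall>x \<in> sphere 0 1 \<inter> ker_form (\<alpha> i). \<theta> x \<in> half_space (\<alpha> i) (\<epsilon> i))"

definition null_homotopic ::
    "'a::topological_space set \<Rightarrow> 'b::topological_space set \<Rightarrow> ('a \<Rightarrow> 'b) \<Rightarrow> bool" where
  "null_homotopic S T f \<longleftrightarrow>
     (\<exists>c\<in>T. homotopic_with_canon (\<lambda>_. True) S T f (\<lambda>_. c))"

end

theory Submission
  imports Defs
begin

text \<open>
  The two directions rest on different ideas; throughout, the forms are replaced by \<open>\<plusminus>\<alpha>\<^sub>i\<close> so that
  all prescribed signs are positive.

  If \<open>p\<close> lies in all the chosen half-spaces, then the straight segment from \<open>x + \<i> \<theta>(x)\<close> to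
  \<open>\<i> p\<close> stays in the complement: a form that vanishes on the real part of an intermediate
  point either vanishes at \<open>x\<close>, and is then positive on both \<open>\<theta>(x)\<close> and \<open>p\<close>, or that point is
  the endpoint \<open>\<i> p\<close>.

  Conversely, a null-homotopy extends the map to \<open>u + \<i> w\<close> on the closed ball, still with values in
  the complement. The ball is simply connected, so each nonvanishing function
  \<open>\<alpha>\<^sub>i(u) + \<i> \<alpha>\<^sub>i(w)\<close> has a continuous argument \<open>\<phi>\<^sub>i\<close> there. On the sphere compatibility
  keeps this function away from the negative imaginary axis, so \<open>\<phi>\<^sub>i\<close> can be chosen with
  boundary values in \<open>(-\<pi>/2, 3\<pi>/2)\<close>. Let \<open>\<tau> = min \<phi>\<^sub>i\<close> and let \<open>G\<close> be the real part of
  \<open>exp(-\<i> \<tau>) (u + \<i> w)\<close>. A form \<open>\<alpha>\<^sub>j\<close> whose argument attains the minimum satisfies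
  \<open>\<alpha>\<^sub>j(G) = \<bar>\<alpha>\<^sub>j(u) + \<i> \<alpha>\<^sub>j(w)\<bar> > 0\<close>, so \<open>G\<close> never vanishes. Suppose that the half-spaces have no
  common point. Then, at each \<open>x\<close> on the sphere, some \<open>\<alpha>\<^sub>i(x)\<close> is nonnegative (otherwise
  \<open>-x\<close> would be a common point), whence \<open>\<tau> \<le> \<pi>/2\<close> and the minimizing form has
  \<open>\<alpha>\<^sub>j(x) \<ge> 0\<close>. So \<open>G(x)\<close> is never a negative multiple of \<open>x\<close>, and the map \<open>-G/\<bar>G\<bar>\<close> of the ball
  to the sphere has no fixed point, against Brouwer's theorem.

  Making the arguments agree with their chosen branch on the sphere requires the sphere to be
  connected. In dimension one, where it is not, an arrangement has at most one hyperplane and the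
  system is always globally consistent.
\<close>

section \<open>Continuous arguments on the ball\<close>

lemma continuous_on_Min_image:
  fixes f :: "'i \<Rightarrow> 'a::topological_space \<Rightarrow> 'b::linorder_topology"
  assumes "finite I" "I \<noteq> {}" "\<And>i. i \<in> I \<Longrightarrow> continuous_on S (f i)"
  shows "continuous_on S (\<lambda>x. Min ((\<lambda>i. f i x) ` I))"
  using assms
proof (induction rule: finite_ne_induct)
  case (insert i I)
  then have "continuous_on S (\<lambda>x. min (f i x) (Min ((\<lambda>i. f i x) ` I)))"
    by (intro continuous_on_min) auto
  with insert.hyps show ?case by simp
qed simp

text \<open>Two logarithms differ by a multiple of \<open>2\<pi>\<i>\<close>, which is constant on the connected
  sphere; subtracting it on the whole ball leaves the prescribed branch on the boundary.\<close>

lemma continuous_logarithm_on_cball_extending_Ln: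
  fixes q :: "'a::euclidean_space \<Rightarrow> complex"
  assumes dim: "2 \<le> DIM('a)" and r: "0 \<le> r"
    and cont: "continuous_on (cball a r) q"
    and nz: "\<And>y. y \<in> cball a r \<Longrightarrow> q y \<noteq> 0"
    and slit: "\<And>x. x \<in> sphere a r \<Longrightarrow> q x \<notin> \<real>\<^sub>\<le>\<^sub>0"
  obtains g where "continuous_on (cball a r) g"
    "\<And>y. y \<in> cball a r \<Longrightarrow> exp (g y) = q y"
    "\<And>x. x \<in> sphere a r \<Longrightarrow> g x = Ln (q x)"
proof -
  obtain h where h: "continuous_on (cball a r) h" "\<And>y. y \<in> cball a r \<Longrightarrow> q y = exp (h y)"
    using continuous_logarithm_on_cball[OF cont nz] by metis
  define d where "d x = h x - Ln (q x)" for x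
  have cont_d: "continuous_on (sphere a r) d"
    unfolding d_def using sphere_cball[of a r] slit
    by (intro continuous_intros continuous_on_subset[OF h(1)] continuous_on_subset[OF cont]) auto
  have d_int: "\<exists>n::int. d x = of_int (2 * n) * pi * \<i>" if "x \<in> sphere a r" for x
  proof -
    have "exp (h x) = exp (Ln (q x))"
      using that h(2) nz sphere_cball[of a r] by (metis exp_Ln subsetD)
    then show ?thesis by (auto simp: exp_eq d_def)
  qed
  have "d constant_on sphere a r"
  proof (rule continuous_discrete_range_constant[OF connected_sphere[OF dim] cont_d])
    fix x assume x: "x \<in> sphere a r"
    have "2 * pi \<le> norm (d y - d x)" if y: "y \<in> sphere a r" "d y \<noteq> d x" for y
    proof -
      obtain m n :: int where mn: "d x = of_int (2 * m) * pi * \<i>" "d y = of_int (2 * n) * pi * \<i>"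
        using d_int x y by meson
      then have "d y - d x = of_real (2 * pi * of_int (n - m)) * \<i>"
        by (simp add: algebra_simps)
      then have "norm (d y - d x) = 2 * pi * \<bar>of_int (n - m)\<bar>"
        by (simp add: norm_mult abs_mult flip: of_int_diff)
      moreover have "n \<noteq> m" using mn y by auto
      then have "(1::real) \<le> \<bar>of_int (n - m)\<bar>" by linarith
      ultimately show ?thesis using pi_gt_zero by (simp add: mult_le_cancel_left1)
    qed
    then show "\<exists>e>0. \<forall>y. y \<in> sphere a r \<and> d y \<noteq> d x \<longrightarrow> e \<le> norm (d y - d x)"
      by (intro exI[of _ "2 * pi"]) auto
  qed
  then obtain c where c: "\<And>x. x \<in> sphere a r \<Longrightarrow> d x = c"
    by (auto simp: constant_on_def)
  obtain x0 where "x0 \<in> sphere a r"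
    using r dim by (metis sphere_eq_empty ex_in_conv not_le DIM_positive)
  then have exp_c: "exp c = 1"
    using c d_int by (force simp: exp_eq_1)
  show ?thesis
  proof
    show "continuous_on (cball a r) (\<lambda>y. h y - c)"
      by (intro continuous_intros h)
    show "exp (h y - c) = q y" if "y \<in> cball a r" for y
      using that h(2) exp_c by (simp add: exp_diff)
    show "h x - c = Ln (q x)" if "x \<in> sphere a r" for x
      using c[OF that] by (simp add: d_def algebra_simps)
  qed
qed

section \<open>The minimal argument and Brouwer's theorem\<close>

text \<open>In the setting of the ball extension \<open>u + \<i> w\<close>, this carries out the minimal-argument
  construction. The logarithms are taken of \<open>\<beta>\<^sub>i(w) - \<i> \<beta>\<^sub>i(u)\<close>, which is \<open>\<beta>\<^sub>i(u) + \<i> \<beta>\<^sub>i(w)\<close> turned by a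
  quarter, so that the forbidden ray becomes the branch cut of the principal logarithm. The
  minimal argument \<open>m\<close> is thus \<open>\<tau> - \<pi>/2\<close>.\<close>

lemma common_positive_point_of_ball_extension:
  fixes \<beta> :: "'i \<Rightarrow> 'a::euclidean_space \<Rightarrow> real" and u w :: "'a \<Rightarrow> 'a"
  assumes dim: "2 \<le> DIM('a)"
    and I: "finite I" "I \<noteq> {}"
    and lin: "\<And>i. i \<in> I \<Longrightarrow> linear (\<beta> i)"
    and cont: "continuous_on (cball 0 1) u" "continuous_on (cball 0 1) w"
    and nz: "\<And>y i. y \<in> cball 0 1 \<Longrightarrow> i \<in> I \<Longrightarrow> \<beta> i (u y) \<noteq> 0 \<or> \<beta> i (w y) \<noteq> 0"
    and bdry: "\<And>x. x \<in> sphere 0 1 \<Longrightarrow> u x = x"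
    and pos: "\<And>x i. x \<in> sphere 0 1 \<Longrightarrow> i \<in> I \<Longrightarrow> \<beta> i x = 0 \<Longrightarrow> \<beta> i (w x) > 0"
  shows "\<exists>p. \<forall>i\<in>I. \<beta> i p > 0"
proof (rule ccontr)
  assume no_point: "\<not> ?thesis"
  define q where "q i y = Complex (\<beta> i (w y)) (- \<beta> i (u y))" for i y
  have "\<exists>g. continuous_on (cball 0 1) g \<and> (\<forall>y\<in>cball 0 1. exp (g y) = q i y) \<and>
            (\<forall>x\<in>sphere 0 1. g x = Ln (q i x))" if i: "i \<in> I" for i
  proof -
    have "continuous_on (cball 0 1) (q i)"
      unfolding q_def using cont lin[OF i]
      by (intro continuous_intros) (auto intro: linear_continuous_on_compose)
    moreover have "q i y \<noteq> 0" if "y \<in> cball 0 1" for y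
      using nz[OF that i] by (auto simp: q_def complex_eq_iff)
    moreover have "q i x \<notin> \<real>\<^sub>\<le>\<^sub>0" if "x \<in> sphere 0 1" for x
      using pos[OF that i] bdry[OF that] by (auto simp: q_def complex_nonpos_Reals_iff)
    ultimately obtain g where "continuous_on (cball 0 1) g"
      "\<And>y. y \<in> cball 0 1 \<Longrightarrow> exp (g y) = q i y"
      "\<And>x. x \<in> sphere 0 1 \<Longrightarrow> g x = Ln (q i x)"
      using continuous_logarithm_on_cball_extending_Ln[OF dim, of 1 0 "q i"]
      by (metis zero_le_one)
    then show ?thesis by blast
  qed
  then obtain g where
    g_cont: "\<And>i. i \<in> I \<Longrightarrow> continuous_on (cball 0 1) (g i)" and
    g_exp: "\<And>i y. i \<in> I \<Longrightarrow> y \<in> cball 0 1 \<Longrightarrow> exp (g i y) = q i y" and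
    g_Ln: "\<And>i x. i \<in> I \<Longrightarrow> x \<in> sphere 0 1 \<Longrightarrow> g i x = Ln (q i x)"
    by metis
  define m where "m y = Min ((\<lambda>i. Im (g i y)) ` I)" for y
  have m_cont: "continuous_on (cball 0 1) m"
    unfolding m_def using I g_cont by (intro continuous_on_Min_image continuous_intros) auto
  have m_le: "m y \<le> Im (g i y)" if "i \<in> I" for i y
    unfolding m_def using I that by auto
  have m_attained: "\<exists>j\<in>I. m y = Im (g j y)" for y
    unfolding m_def using Min_in[of "(\<lambda>i. Im (g i y)) ` I"] I by (simp add: image_iff)
  have polar: "\<beta> i (w y) = exp (Re (g i y)) * cos (Im (g i y))"
    "\<beta> i (u y) = - (exp (Re (g i y)) * sin (Im (g i y)))" if "i \<in> I" "y \<in> cball 0 1" for i y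
    using g_exp[OF that] by (auto simp: q_def complex_eq_iff Re_exp Im_exp)
  define G where "G y = cos (m y) *\<^sub>R w y - sin (m y) *\<^sub>R u y" for y
  have G_cont: "continuous_on (cball 0 1) G"
    unfolding G_def by (intro continuous_intros cont m_cont)
  have G_pos: "\<beta> j (G y) > 0" if "j \<in> I" "y \<in> cball 0 1" "m y = Im (g j y)" for j y
  proof -
    have "\<beta> j (G y) = cos (m y) * \<beta> j (w y) - sin (m y) * \<beta> j (u y)"
      using lin[OF that(1)] by (simp add: G_def linear_diff linear_cmul)
    also have "\<dots> = exp (Re (g j y)) * ((sin (m y))\<^sup>2 + (cos (m y))\<^sup>2)"
      by (simp only: that(3) polar[OF that(1,2)]) algebra
    also have "\<dots> = exp (Re (g j y))" by simp
    finally show ?thesis by simp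
  qed
  have G_nz: "G y \<noteq> 0" if "y \<in> cball 0 1" for y
  proof -
    obtain j where j: "j \<in> I" "m y = Im (g j y)" using m_attained by blast
    show ?thesis using G_pos[OF j(1) that j(2)] linear_0[OF lin[OF j(1)]] by auto
  qed
  \<comment> \<open>This is the only place where the absence of a common positive point enters, through \<open>-x\<close>.\<close>
  have minimizer_nonneg: "\<beta> j x \<ge> 0" if "j \<in> I" "x \<in> sphere 0 1" "m x = Im (g j x)" for j x
  proof -
    have x: "x \<in> cball 0 1" using that by auto
    obtain i where i: "i \<in> I" "\<not> \<beta> i (- x) > 0"
      using no_point by blast
    have "\<not> Im (q i x) > 0"
      using i(2) bdry[OF that(2)] linear_neg[OF lin[OF i(1)]] by (simp add: q_def)
    moreover have "q i x \<noteq> 0" using g_exp[OF i(1) x] by (metis exp_not_eq_zero)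
    moreover have "q i x \<notin> \<real>\<^sub>\<le>\<^sub>0"
      using pos[OF that(2) i(1)] bdry[OF that(2)] by (auto simp: q_def complex_nonpos_Reals_iff)
    ultimately have "Im (Ln (q i x)) \<le> 0"
      using Im_Ln_pos_lt Im_Ln_less_pi by (meson not_le)
    then have "Im (g j x) \<le> 0"
      using m_le[OF i(1), of x] g_Ln[OF i(1) that(2)] that(3) by simp
    moreover have "q j x \<noteq> 0" using g_exp[OF that(1) x] by (metis exp_not_eq_zero)
    then have "- pi < Im (g j x)"
      using g_Ln[OF that(1,2)] mpi_less_Im_Ln by simp
    ultimately have "sin (Im (g j x)) \<le> 0"
      using sin_ge_zero[of "- Im (g j x)"] by simp
    then show ?thesis
      using polar(2)[OF that(1) x] bdry[OF that(2)] by (simp add: mult_le_0_iff)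
  qed
  have "continuous_on (cball 0 1) (\<lambda>y. - (inverse (norm (G y)) *\<^sub>R G y))"
    using G_nz by (intro continuous_intros G_cont) auto
  moreover have "norm (inverse (norm (G y)) *\<^sub>R G y) = 1" if "y \<in> cball 0 1" for y
    using G_nz[OF that] by simp
  ultimately obtain x where x: "x \<in> cball 0 1" "- (inverse (norm (G x)) *\<^sub>R G x) = x"
    using brouwer_ball[of 1 0 "\<lambda>y. - (inverse (norm (G y)) *\<^sub>R G y)"]
    by (auto simp: dist_norm)
  then have x_sphere: "x \<in> sphere 0 1"
    using G_nz[OF x(1)] by (metis dist_0_norm mem_sphere norm_minus_cancel norm_scaleR
      abs_inverse abs_norm_cancel left_inverse norm_eq_zero)
  obtain j where j: "j \<in> I" "m x = Im (g j x)" using m_attained by blast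
  have "\<beta> j x = - (inverse (norm (G x)) * \<beta> j (G x))"
    using lin[OF j(1)] by (subst x(2)[symmetric]) (simp add: linear_neg linear_cmul)
  moreover have "inverse (norm (G x)) * \<beta> j (G x) > 0"
    using G_pos[OF j(1) x(1) j(2)] G_nz[OF x(1)] by simp
  ultimately show False
    using minimizer_nonneg[OF j(1) x_sphere j(2)] by simp
qed

section \<open>Signed forms and the complexified complement\<close>

definition signed_form :: "('a::real_vector \<Rightarrow> real) \<Rightarrow> pm \<Rightarrow> 'a \<Rightarrow> real" where
  "signed_form a e x = (case e of Plus \<Rightarrow> a x | Minus \<Rightarrow> - a x)"

lemma mem_half_space_iff: "x \<in> half_space a e \<longleftrightarrow> signed_form a e x > 0"
  by (cases e) (auto simp: signed_form_def)

lemma signed_form_eq_0_iff: "signed_form a e x = 0 \<longleftrightarrow> a x = 0"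
  by (cases e) (auto simp: signed_form_def)

lemma linear_signed_form: "linear a \<Longrightarrow> linear (signed_form a e)"
  by (cases e) (auto simp: signed_form_def[abs_def] intro: linear_compose_neg)

lemma globally_consistent_iff:
  "globally_consistent n \<alpha> \<epsilon> \<longleftrightarrow> (\<exists>p. \<forall>i\<in>{1..n}. signed_form (\<alpha> i) (\<epsilon> i) p > 0)"
  unfolding globally_consistent_def ex_in_conv[symmetric] INT_iff mem_half_space_iff ..

lemma mem_complexified_complement_iff:
  "z \<in> complexified_complement n \<alpha> \<longleftrightarrow>
     (\<forall>i\<in>{1..n}. \<alpha> i (\<chi> k. Re (z $ k)) \<noteq> 0 \<or> \<alpha> i (\<chi> k. Im (z $ k)) \<noteq> 0)"
proof -
  have "z \<in> complexify H \<longleftrightarrow> (\<chi> k. Re (z $ k)) \<in> H \<and> (\<chi> k. Im (z $ k)) \<in> H" for H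
  proof
    assume "(\<chi> k. Re (z $ k)) \<in> H \<and> (\<chi> k. Im (z $ k)) \<in> H"
    moreover have "z = complex_point (\<chi> k. Re (z $ k)) (\<chi> k. Im (z $ k))"
      by (simp add: complex_point_def vec_eq_iff)
    ultimately show "z \<in> complexify H" unfolding complexify_def by blast
  qed (auto simp: complexify_def complex_point_def)
  then show ?thesis
    by (auto simp: complexified_complement_def arrangement_def ker_form_def)
qed

lemma Re_complex_point [simp]: "(\<chi> k. Re (complex_point x v $ k)) = x"
  and Im_complex_point [simp]: "(\<chi> k. Im (complex_point x v $ k)) = v"
  by (simp_all add: complex_point_def vec_eq_iff)

lemma continuous_on_complex_point:
  "continuous_on S f \<Longrightarrow> continuous_on S g \<Longrightarrow> continuous_on S (\<lambda>x. complex_point (f x) (g x))"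
  unfolding complex_point_def by (intro continuous_intros)

section \<open>Null-homotopy and global consistency\<close>

lemma closed_segment_subset_complexified_complement:
  assumes lin: "\<And>i. i \<in> {1..n} \<Longrightarrow> linear (\<alpha> i)"
    and p: "\<And>i. i \<in> {1..n} \<Longrightarrow> signed_form (\<alpha> i) (\<epsilon> i) p > 0"
    and v: "\<And>i. i \<in> {1..n} \<Longrightarrow> \<alpha> i x = 0 \<Longrightarrow> signed_form (\<alpha> i) (\<epsilon> i) v > 0"
  shows "closed_segment (complex_point x v) (complex_point 0 p) \<subseteq> complexified_complement n \<alpha>"
proof
  fix z assume "z \<in> closed_segment (complex_point x v) (complex_point 0 p)"
  then obtain s where s: "0 \<le> s" "s \<le> 1"
    and z: "z = (1 - s) *\<^sub>R complex_point x v + s *\<^sub>R complex_point 0 p"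
    by (auto simp: closed_segment_def)
  have z': "z = complex_point ((1 - s) *\<^sub>R x) ((1 - s) *\<^sub>R v + s *\<^sub>R p)"
    by (simp add: z complex_point_def vec_eq_iff complex_eq_iff)
  have "\<alpha> i ((1 - s) *\<^sub>R v + s *\<^sub>R p) \<noteq> 0" if i: "i \<in> {1..n}" and "\<alpha> i ((1 - s) *\<^sub>R x) = 0" for i
  proof -
    let ?b = "signed_form (\<alpha> i) (\<epsilon> i)"
    have b: "?b ((1 - s) *\<^sub>R v + s *\<^sub>R p) = (1 - s) * ?b v + s * ?b p"
      using linear_signed_form[OF lin[OF i]] by (simp add: linear_add linear_cmul)
    have "s = 1 \<or> \<alpha> i x = 0"
      using that lin[OF i] by (simp add: linear_cmul)
    then have "(1 - s) * ?b v + s * ?b p > 0"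
    proof
      assume "\<alpha> i x = 0"
      then show ?thesis
        using convex_bound_lt[of "- ?b v" 0 "- ?b p" "1 - s" s] v[OF i] p[OF i] s by simp
    qed (use p[OF i] in simp)
    with b show ?thesis by (metis less_irrefl signed_form_eq_0_iff)
  qed
  then show "z \<in> complexified_complement n \<alpha>"
    unfolding z' mem_complexified_complement_iff by auto
qed

text \<open>On a line every nonzero form has kernel \<open>{0}\<close>, and the hyperplanes are distinct, so there is
  at most one of them.\<close>

lemma globally_consistent_if_DIM_1:
  fixes \<alpha> :: "nat \<Rightarrow> 'a::euclidean_space \<Rightarrow> real"
  assumes "DIM('a) = 1" and "central_arrangement n \<alpha>"
  shows "globally_consistent n \<alpha> \<epsilon>"
proof -
  have ker: "ker_form (\<alpha> i) = {0}" if i: "i \<in> {1..n}" for i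
  proof -
    have lin: "linear (\<alpha> i)" and "\<exists>x. \<alpha> i x \<noteq> 0"
      using assms(2) i by (auto simp: central_arrangement_def)
    then obtain x where x: "\<alpha> i x \<noteq> 0" by blast
    obtain b where basis: "(Basis :: 'a set) = {b}"
      using assms(1) by (metis card_1_singletonE)
    have multiple: "(y \<bullet> b) *\<^sub>R b = y" for y :: 'a
      using euclidean_representation[of y] unfolding basis by simp
    have form: "\<alpha> i y = (y \<bullet> b) * \<alpha> i b" for y
      using linear_cmul[OF lin, of "y \<bullet> b" b] multiple[of y] by simp
    have "y = 0" if "\<alpha> i y = 0" for y
      using that form[of x] form[of y] x multiple[of y] by (metis mult_eq_0_iff scaleR_zero_left)
    then show ?thesis using lin by (auto simp: ker_form_def linear_0)
  qed
  have single: "i = 1" if i: "i \<in> {1..n}" for i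
  proof -
    have inj: "inj_on (\<lambda>i. ker_form (\<alpha> i)) {1..n}"
      using assms(2) by (simp add: central_arrangement_def)
    have one: "1 \<in> {1..n}" using i by simp
    show ?thesis by (rule inj_onD[OF inj _ i one]) (simp only: ker[OF i] ker[OF one])
  qed
  have "\<exists>p. \<forall>i\<in>{1..n}. signed_form (\<alpha> i) (\<epsilon> i) p > 0"
  proof (cases "1 \<in> {1..n}")
    case True
    let ?b = "signed_form (\<alpha> 1) (\<epsilon> 1)"
    have lin: "linear ?b" and "\<exists>x. \<alpha> 1 x \<noteq> 0"
      using assms(2) True by (auto simp: central_arrangement_def linear_signed_form)
    then obtain x where "?b x \<noteq> 0" by (auto simp: signed_form_eq_0_iff)
    then have "?b x > 0 \<or> ?b (- x) > 0" using linear_neg[OF lin, of x] by auto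
    then show ?thesis using single by metis
  qed (use single in blast)
  then show ?thesis by (simp add: globally_consistent_iff)
qed

theorem theorem3p3:
  fixes n :: nat
    and \<alpha> :: "nat \<Rightarrow> real^'l \<Rightarrow> real"
    and \<epsilon> :: "nat \<Rightarrow> pm"
    and \<theta> :: "real^'l \<Rightarrow> real^'l"
  assumes "central_arrangement n \<alpha>"
    and "essential_arrangement n \<alpha>"
    and "locally_consistent n \<alpha> \<epsilon>"
    and "sphere_vector_field \<theta>"
    and "compatible n \<alpha> \<epsilon> \<theta>"
  shows "null_homotopic (sphere 0 1) (complexified_complement n \<alpha>)
           (\<lambda>x. complex_point x (\<theta> x))
         \<longleftrightarrow> globally_consistent n \<alpha> \<epsilon>"
proof
  have lin: "linear (\<alpha> i)" if "i \<in> {1..n}" for i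
    using assms(1) that by (auto simp: central_arrangement_def)
  have \<theta>_cont: "continuous_on (sphere 0 1) \<theta>"
    using assms(4) by (simp add: sphere_vector_field_def)
  have \<theta>_pos: "signed_form (\<alpha> i) (\<epsilon> i) (\<theta> x) > 0"
    if "i \<in> {1..n}" "x \<in> sphere 0 1" "\<alpha> i x = 0" for i x
    using assms(5) that by (auto simp: compatible_def ker_form_def mem_half_space_iff)
  let ?M = "complexified_complement n \<alpha>"
  {
    assume "globally_consistent n \<alpha> \<epsilon>"
    then obtain p where p: "\<And>i. i \<in> {1..n} \<Longrightarrow> signed_form (\<alpha> i) (\<epsilon> i) p > 0"
      unfolding globally_consistent_iff by blast
    have "complex_point 0 p \<in> ?M"
      unfolding mem_complexified_complement_iff using p
      by (metis Im_complex_point less_irrefl signed_form_eq_0_iff)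
    moreover have "homotopic_with_canon (\<lambda>_. True) (sphere 0 1) ?M
        (\<lambda>x. complex_point x (\<theta> x)) (\<lambda>_. complex_point 0 p)"
      using lin p \<theta>_pos
      by (intro homotopic_with_linear closed_segment_subset_complexified_complement
            continuous_on_complex_point continuous_on_id continuous_on_const \<theta>_cont) auto
    ultimately show "null_homotopic (sphere 0 1) ?M (\<lambda>x. complex_point x (\<theta> x))"
      unfolding null_homotopic_def by blast
  }
  assume "null_homotopic (sphere 0 1) ?M (\<lambda>x. complex_point x (\<theta> x))"
  then obtain F where F: "continuous_on (cball 0 1) F" "F ` cball 0 1 \<subseteq> ?M"
    "\<And>x. x \<in> sphere 0 1 \<Longrightarrow> F x = complex_point x (\<theta> x)"
    using nullhomotopic_from_sphere_extension[of 0 1 ?M "\<lambda>x. complex_point x (\<theta> x)"]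
    unfolding null_homotopic_def by blast
  show "globally_consistent n \<alpha> \<epsilon>"
  proof (cases "DIM(real^'l) = 1 \<or> n = 0")
    case True
    then show ?thesis
    proof
      assume "n = 0"
      then show ?thesis by (simp add: globally_consistent_iff)
    qed (use globally_consistent_if_DIM_1 assms(1) in blast)
  next
    case False
    have "2 \<le> DIM(real^'l)"
      using False DIM_positive[where 'a="real^'l"] by linarith
    then have "\<exists>p. \<forall>i\<in>{1..n}. signed_form (\<alpha> i) (\<epsilon> i) p > 0"
    proof (rule common_positive_point_of_ball_extension[where
          u = "\<lambda>y. \<chi> k. Re (F y $ k)" and w = "\<lambda>y. \<chi> k. Im (F y $ k)"])
      show "continuous_on (cball 0 1) (\<lambda>y. \<chi> k. Re (F y $ k))"
        "continuous_on (cball 0 1) (\<lambda>y. \<chi> k. Im (F y $ k))"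
        by (intro continuous_intros F(1))+
      show "signed_form (\<alpha> i) (\<epsilon> i) (\<chi> k. Re (F y $ k)) \<noteq> 0 \<or>
            signed_form (\<alpha> i) (\<epsilon> i) (\<chi> k. Im (F y $ k)) \<noteq> 0"
        if "y \<in> cball 0 1" "i \<in> {1..n}" for y i
        using F(2) that unfolding signed_form_eq_0_iff
        by (metis image_subset_iff mem_complexified_complement_iff)
    qed (use False lin linear_signed_form \<theta>_pos F(3) in \<open>auto simp: signed_form_eq_0_iff\<close>)
    then show ?thesis by (simp add: globally_consistent_iff)
  qed
qed

end
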